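(* Let $u:V\times[0,T_{\max}(u_0))\to\mathbb{R}$ be the solution of $$\partial_t u=\Delta u-au+|u|^{p-1}u\quad (x\in V,\ t>0),\qquad u(x,0)=u_0(x)\quad (x\in V)$$ with $u_0\geq 0$, where $[0,T_{\max}(u_0))$ is the maximal time interval on which the solution exists. Then the following assertions are true. (i) If $$\int_V u_0\,d\mu>\left(\max_{x\in V}a(x)\right)^{1/(p-1)}|V|,$$ then $$T_{\max}(u_0)\leq\frac{1}{(p-1)\max_{x\in V}a(x)}\log\frac{1}{1-|V|^{p-1}\max_{x\in V}a(x)\left(\int_V u_0\,d\mu\right)^{1-p}}.$$ (ii) If $$\int_V\varphi u_0\,d\mu>\lambda_a^{\frac{1}{p-1}}\int_V\varphi\,d\mu,$$ then $$T_{\max}(u_0)\leq\frac{1}{(p-1)\lambda_a}\log\frac{1}{1-\lambda_a\left(\int_V\varphi\,d\mu\right)^{p-1}\left(\int_V\varphi u_0\,d\mu\right)^{1-p}}.$$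
   Context: $G=(V,E,\mu,\omega)$ is a finite connected graph with positive measure $\mu:V\to(0,\infty)$ and positive symmetric edge weights $\omega_{xy}=\omega_{yx}>0$; $y\sim x$ means that $x,y$ are joined by an edge. The $\mu$-Laplacian is $\Delta u(x)=\frac{1}{\mu(x)}\sum_{y\sim x}\omega_{xy}(u(y)-u(x))$. $\int_V f\,d\mu=\sum_{x\in V}\mu(x)f(x)$ and $|V|=\int_V1\,d\mu=\sum_{x\in V}\mu(x)$. Fixed data: $p>1$ and $a:V\to\mathbb{R}$ with $a\ge 0$ on $V$ and $a\not\equiv 0$. $\lambda_a$ is the first (smallest) eigenvalue of $-\Delta+a$ (it is positive) and $\varphi$ is a corresponding eigenfunction, $-\Delta\varphi+a\varphi=\lambda_a\varphi$, chosen with $\varphi(x)>0$ for all $x\in V$. Solutions are $C^1$ in $t$ for each $x\in V$. *)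

theory Defs
  imports "HOL-Analysis.Analysis" "Graph_Theory.Graph_Theory"
begin

text \<open>
  A finite connected weighted graph. An undirected edge is a symmetric pair of arcs, so
  \<open>(x, y) \<in> parcs G\<close> is the relation \<open>x \<sim> y\<close>. Loops are not excluded: they contribute
  nothing to the Laplacian. Connectedness includes that the vertex set is not empty.
\<close>
locale weighted_graph = pair_pseudo_graph G
  for G :: "'v pair_pre_digraph" +
  fixes \<mu> :: "'v \<Rightarrow> real" and \<omega> :: "'v \<Rightarrow> 'v \<Rightarrow> real"
  assumes connected_graph: "Digraph_Component.connected (with_proj G)"
    and measure_pos: "x \<in> pverts G \<Longrightarrow> \<mu> x > 0"
    and weight_pos: "(x, y) \<in> parcs G \<Longrightarrow> \<omega> x y > 0"
    and weight_sym: "(x, y) \<in> parcs G \<Longrightarrow> \<omega> x y = \<omega> y x"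

definition graph_integral :: "'v pair_pre_digraph \<Rightarrow> ('v \<Rightarrow> real) \<Rightarrow> ('v \<Rightarrow> real) \<Rightarrow> real"
  where "graph_integral G \<mu> f = (\<Sum>x\<in>pverts G. \<mu> x * f x)"

definition graph_volume :: "'v pair_pre_digraph \<Rightarrow> ('v \<Rightarrow> real) \<Rightarrow> real"
  where "graph_volume G \<mu> = graph_integral G \<mu> (\<lambda>x. 1)"

definition laplacian ::
  "'v pair_pre_digraph \<Rightarrow> ('v \<Rightarrow> real) \<Rightarrow> ('v \<Rightarrow> 'v \<Rightarrow> real) \<Rightarrow> ('v \<Rightarrow> real) \<Rightarrow> 'v \<Rightarrow> real"
  where "laplacian G \<mu> \<omega> f x =
    1 / \<mu> x * (\<Sum>y \<in> {y. (x, y) \<in> parcs G}. \<omega> x y * (f y - f x))"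

text \<open>
  Eigenfunctions of \<open>-\<Delta> + a\<close>. Functions on the vertex set are total functions whose
  values outside \<open>pverts G\<close> are irrelevant. The operator is self-adjoint for
  \<open>\<mu>\<close>, so all its eigenvalues are real.
\<close>
definition eigenfunction ::
  "'v pair_pre_digraph \<Rightarrow> ('v \<Rightarrow> real) \<Rightarrow> ('v \<Rightarrow> 'v \<Rightarrow> real) \<Rightarrow> ('v \<Rightarrow> real) \<Rightarrow> real \<Rightarrow>
    ('v \<Rightarrow> real) \<Rightarrow> bool"
  where "eigenfunction G \<mu> \<omega> a l f \<longleftrightarrow>
    (\<exists>x\<in>pverts G. f x \<noteq> 0) \<and>
    (\<forall>x\<in>pverts G. - laplacian G \<mu> \<omega> f x + a x * f x = l * f x)"

definition first_eigenvalue ::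
  "'v pair_pre_digraph \<Rightarrow> ('v \<Rightarrow> real) \<Rightarrow> ('v \<Rightarrow> 'v \<Rightarrow> real) \<Rightarrow> ('v \<Rightarrow> real) \<Rightarrow> real"
  where "first_eigenvalue G \<mu> \<omega> a = (LEAST l. \<exists>f. eigenfunction G \<mu> \<omega> a l f)"

definition time_interval :: "ereal \<Rightarrow> real set"
  where "time_interval T = {t. 0 \<le> t \<and> ereal t < T}"

text \<open>
  \<open>u\<close> solves \<open>\<partial>\<^sub>t u = \<Delta> u - a u + \<bar>u\<bar>\<^sup>p\<^sup>-\<^sup>1 u\<close>, \<open>u(\<cdot>, 0) = u\<^sub>0\<close>
  on \<open>[0, T)\<close>, where \<open>T\<close> may be infinite. The derivative \<open>D\<close> is one-sided at \<open>t = 0\<close>,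
  so values of \<open>u\<close> at times outside \<open>[0, T)\<close> play no role.
\<close>
definition solution_on ::
  "'v pair_pre_digraph \<Rightarrow> ('v \<Rightarrow> real) \<Rightarrow> ('v \<Rightarrow> 'v \<Rightarrow> real) \<Rightarrow> ('v \<Rightarrow> real) \<Rightarrow> real \<Rightarrow>
    ('v \<Rightarrow> real) \<Rightarrow> ereal \<Rightarrow> ('v \<Rightarrow> real \<Rightarrow> real) \<Rightarrow> bool"
  where "solution_on G \<mu> \<omega> a p u0 T u \<longleftrightarrow>
    0 < T \<and>
    (\<forall>x\<in>pverts G. u x 0 = u0 x) \<and>
    (\<forall>x\<in>pverts G. \<exists>D. continuous_on (time_interval T) D \<and>
      (\<forall>t\<in>time_interval T. (u x has_real_derivative D t) (at t within time_interval T)) \<and>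
      (\<forall>t\<in>time_interval T. 0 < t \<longrightarrow>
        D t = laplacian G \<mu> \<omega> (\<lambda>y. u y t) x - a x * u x t
              + \<bar>u x t\<bar> powr (p - 1) * u x t))"

text \<open>
  Since the nonlinearity is locally Lipschitz for \<open>p > 1\<close>, solutions with the same initial
  value agree on common intervals of existence, so the maximal existence time is the
  supremum of all \<open>T\<close> for which there is a solution on \<open>[0, T)\<close>.
\<close>
definition T_max ::
  "'v pair_pre_digraph \<Rightarrow> ('v \<Rightarrow> real) \<Rightarrow> ('v \<Rightarrow> 'v \<Rightarrow> real) \<Rightarrow> ('v \<Rightarrow> real) \<Rightarrow> real \<Rightarrow>
    ('v \<Rightarrow> real) \<Rightarrow> ereal"
  where "T_max G \<mu> \<omega> a p u0 = Sup {T. \<exists>u. solution_on G \<mu> \<omega> a p u0 T u}"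

end

theory Submission
  imports Defs
begin

text \<open>
  The idea is Kaplan's eigenfunction method: test the equation against a positive weight
  \<open>\<psi>\<close> and watch the single number \<open>F(t) = \<integral> \<psi> u(t) d\<mu>\<close>. If \<open>- \<Delta>\<psi> + a \<psi> \<le> \<Lambda> \<psi>\<close>, then
  moving the Laplacian onto \<open>\<psi>\<close> and applying Jensen's inequality to the convex function
  \<open>z\<^sup>p\<close> on \<open>z \<ge> 0\<close> gives the Bernoulli differential inequality
  \<open>F' \<ge> - \<Lambda> F + K\<^sup>1\<^sup>-\<^sup>p F\<^sup>p\<close> with \<open>K = \<integral> \<psi> d\<mu>\<close>. The substitution \<open>v = F\<^sup>1\<^sup>-\<^sup>p\<close> makes it
  linear; if \<open>F(0)\<close> is above the equilibrium \<open>\<Lambda>\<^sup>1\<^sup>/\<^sup>(\<^sup>p\<^sup>-\<^sup>1\<^sup>) K\<close>, the linear inequality would force \<open>v\<close> to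
  vanish at an explicit time, while \<open>v > 0\<close> as long as the solution exists. This is
  \<open>existence_time_bound\<close>, resting on \<open>bernoulli_blow_up_time\<close> and \<open>jensen_powr\<close>.

  Both assertions are instances. For (i) take \<open>\<psi> = 1\<close> and \<open>\<Lambda> = max a\<close>; for (ii) take
  \<open>\<psi> = \<phi>\<close> and \<open>\<Lambda> = \<lambda>\<^sub>a\<close>, where \<open>\<lambda>\<^sub>a > 0\<close> follows by integrating the eigenvalue equation
  (\<open>positive_eigenvalue\<close>).

  Jensen's inequality needs \<open>u \<ge> 0\<close>. This is \<open>solution_nonneg\<close>: the energy
  \<open>\<integral> min(u, 0)\<^sup>2 d\<mu>\<close> starts at \<open>0\<close>, and since diffusion and absorption can only decrease
  it while the reaction rate is bounded on compact time intervals, it stays \<open>0\<close>.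
\<close>

section \<open>Differential inequalities in one variable\<close>

lemma gronwall_exp:
  fixes f f' :: "real \<Rightarrow> real"
  assumes "0 \<le> t" and cont: "continuous_on {0..t} f"
    and deriv: "\<And>s. 0 < s \<Longrightarrow> s < t \<Longrightarrow> (f has_real_derivative f' s) (at s)"
    and le: "\<And>s. 0 < s \<Longrightarrow> s < t \<Longrightarrow> f' s \<le> c * f s"
  shows "f t \<le> f 0 * exp (c * t)"
proof -
  let ?g = "\<lambda>s. f s * exp (- c * s)"
  have "?g t \<le> ?g 0"
  proof (rule DERIV_nonpos_imp_decreasing_open [OF \<open>0 \<le> t\<close>])
    fix s assume s: "0 < s" "s < t"
    have "(?g has_real_derivative (f' s - c * f s) * exp (- c * s)) (at s)"
      by (rule derivative_eq_intros deriv [OF s] refl | simp add: algebra_simps)+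
    moreover have "(f' s - c * f s) * exp (- c * s) \<le> 0"
      using le [OF s] by (simp add: mult_nonpos_nonneg)
    ultimately show "\<exists>y. (?g has_real_derivative y) (at s) \<and> y \<le> 0"
      by blast
  qed (intro continuous_intros cont)
  then have "f t * exp (- c * t) * exp (c * t) \<le> f 0 * exp (c * t)"
    by (intro mult_right_mono) auto
  then show ?thesis
    by (simp add: mult.assoc flip: exp_add)
qed

text \<open>
  A convex function lies above its tangents. The point \<open>z = 0\<close>, where \<open>z powr p\<close> has no
  second derivative for \<open>p < 2\<close>, is treated separately.
\<close>
lemma powr_ge_tangent:
  fixes m z p :: real
  assumes "p > 1" "m > 0" "z \<ge> 0"
  shows "m powr p + p * m powr (p - 1) * (z - m) \<le> z powr p"
proof (cases "z = 0")
  case True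
  have "m powr (p - 1) * m = m powr p"
    using \<open>m > 0\<close> by (simp add: powr_diff)
  then have "m powr p + p * m powr (p - 1) * (z - m) = (1 - p) * m powr p"
    using True by (simp add: algebra_simps)
  then show ?thesis
    using assms True by (simp add: mult_nonpos_nonneg)
next
  case False
  have "z powr p - m powr p \<ge> p * m powr (p - 1) * (z - m)"
  proof (rule convex_on_imp_above_tangent [where A = "{0<..}"])
    show "convex_on {0<..} (\<lambda>x. x powr p)"
      using assms by (intro powr_convex) auto
    show "((\<lambda>x. x powr p) has_real_derivative p * m powr (p - 1)) (at m within {0<..})"
      using \<open>m > 0\<close> by (rule has_field_derivative_at_within [OF has_real_derivative_powr])
  qed (use assms False in \<open>auto simp: interior_open\<close>)
  then show ?thesis
    by simp
qed

text \<open>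
  Sum the tangent inequality at the weighted mean \<open>m\<close>: the linear terms cancel. The weights
  are not normalised, which is where the factor \<open>K\<^sup>1\<^sup>-\<^sup>p\<close> for the total weight \<open>K\<close> comes from.
\<close>
lemma jensen_powr:
  fixes c z :: "'a \<Rightarrow> real" and p :: real
  assumes "finite S" "p > 1" "\<And>i. i \<in> S \<Longrightarrow> c i \<ge> 0" "\<And>i. i \<in> S \<Longrightarrow> z i \<ge> 0"
    and K: "sum c S > 0"
  shows "sum c S powr (1 - p) * (\<Sum>i\<in>S. c i * z i) powr p \<le> (\<Sum>i\<in>S. c i * z i powr p)"
proof -
  define K F where "K = sum c S" and "F = (\<Sum>i\<in>S. c i * z i)"
  have "F \<ge> 0"
    unfolding F_def using assms by (intro sum_nonneg) auto
  show ?thesis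
  proof (cases "F = 0")
    case True
    then show ?thesis
      using assms by (auto simp: F_def intro!: sum_nonneg)
  next
    case False
    define m where "m = F / K"
    have "K > 0" "F > 0" "m > 0"
      using K False \<open>F \<ge> 0\<close> by (auto simp: K_def m_def)
    have "K powr (1 - p) * F powr p = K * m powr p"
      using \<open>K > 0\<close> \<open>F > 0\<close> by (simp add: m_def powr_divide powr_diff)
    also have "\<dots> = (\<Sum>i\<in>S. c i * m powr p) + p * m powr (p - 1) * (F - m * K)"
      using \<open>K > 0\<close> by (simp add: K_def m_def sum_distrib_right)
    also have "\<dots> = (\<Sum>i\<in>S. c i * (m powr p + p * m powr (p - 1) * (z i - m)))"
      unfolding F_def K_def
      by (simp add: algebra_simps sum.distrib sum_subtractf sum_distrib_left)
    also have "\<dots> \<le> (\<Sum>i\<in>S. c i * z i powr p)"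
      using assms \<open>m > 0\<close> by (intro sum_mono mult_left_mono powr_ge_tangent) auto
    finally show ?thesis
      by (simp add: K_def F_def)
  qed
qed

text \<open>
  The function \<open>v = F\<^sup>1\<^sup>-\<^sup>p\<close> satisfies \<open>v' \<le> (p - 1) (\<Lambda> v - k)\<close>, so that the gap
  \<open>k / \<Lambda> - v\<close> grows at least exponentially. It starts positive because \<open>F 0\<close> is above the
  equilibrium, and it must stay below \<open>k / \<Lambda>\<close> because \<open>v > 0\<close>.
\<close>
lemma bernoulli_blow_up_time:
  fixes F F' :: "real \<Rightarrow> real" and \<Lambda> k p t :: real
  assumes "p > 1" "\<Lambda> > 0" "k > 0" "0 \<le> t" and cont: "continuous_on {0..t} F"
    and deriv: "\<And>s. 0 < s \<Longrightarrow> s < t \<Longrightarrow> (F has_real_derivative F' s) (at s)"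
    and ge: "\<And>s. 0 < s \<Longrightarrow> s < t \<Longrightarrow> F' s \<ge> - \<Lambda> * F s + k * F s powr p"
    and F0: "F 0 > 0" and large: "\<Lambda> < k * F 0 powr (p - 1)"
  shows "t < 1 / ((p - 1) * \<Lambda>) * ln (1 / (1 - \<Lambda> / k * F 0 powr (1 - p)))"
proof -
  \<comment> \<open>Dropping the superlinear term leaves \<open>F' \<ge> - \<Lambda> F\<close>, and \<open>F\<close> cannot reach zero.\<close>
  have pos: "F s > 0" if "0 \<le> s" "s \<le> t" for s
  proof -
    have "- F s \<le> - F 0 * exp (- \<Lambda> * s)"
    proof (rule gronwall_exp [where f = "\<lambda>s. - F s" and f' = "\<lambda>s. - F' s"])
      fix r assume "0 < r" "r < s"
      then have r: "0 < r" "r < t"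
        using that by auto
      show "((\<lambda>s. - F s) has_real_derivative - F' r) (at r)"
        by (intro DERIV_minus deriv r)
      have "0 \<le> k * F r powr p"
        using \<open>k > 0\<close> by simp
      then show "- F' r \<le> - \<Lambda> * - F r"
        using ge [OF r] by simp
    qed (use that in \<open>auto intro!: continuous_intros continuous_on_subset [OF cont]\<close>)
    moreover have "F 0 * exp (- \<Lambda> * s) > 0"
      using F0 by simp
    ultimately show ?thesis
      by linarith
  qed
  define v where "v = (\<lambda>s. F s powr (1 - p))"
  have v_cont: "continuous_on {0..t} v"
    unfolding v_def
    by (intro continuous_on_powr cont continuous_on_const) (use pos in force)
  define b where "b = k / \<Lambda>"
  have "b > 0"
    using assms by (simp add: b_def)
  have v_less: "v 0 < b"
  proof -
    have "v 0 * F 0 powr (p - 1) = 1"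
      using F0 by (simp add: v_def flip: powr_add)
    moreover have "v 0 > 0"
      using F0 by (simp add: v_def)
    then have "v 0 * \<Lambda> < v 0 * (k * F 0 powr (p - 1))"
      using large by (intro mult_strict_left_mono)
    ultimately have "v 0 * \<Lambda> < k"
      by (simp add: mult.left_commute)
    then show ?thesis
      using \<open>\<Lambda> > 0\<close> by (simp add: b_def pos_less_divide_eq)
  qed
  have "v t - b \<le> (v 0 - b) * exp ((p - 1) * \<Lambda> * t)"
  proof (rule gronwall_exp [where f = "\<lambda>s. v s - b" and f' = "\<lambda>s. (1 - p) * F s powr (- p) * F' s"])
    fix s assume s: "0 < s" "s < t"
    then have "F s > 0"
      using pos by simp
    then have "(v has_real_derivative (1 - p) * F s powr (1 - p - 1) * F' s) (at s)"
      unfolding v_def by (intro DERIV_chain2 [OF has_real_derivative_powr] deriv [OF s])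
    then show "((\<lambda>s. v s - b) has_real_derivative (1 - p) * F s powr (- p) * F' s) (at s)"
      by (auto intro!: derivative_eq_intros)
    have "(p - 1) * F s powr (- p) * (- \<Lambda> * F s + k * F s powr p)
        \<le> (p - 1) * F s powr (- p) * F' s"
      using ge [OF s] \<open>p > 1\<close> by (intro mult_left_mono) auto
    also have "(p - 1) * F s powr (- p) * (- \<Lambda> * F s + k * F s powr p) = (p - 1) * (- \<Lambda> * v s + k)"
      using \<open>F s > 0\<close> by (simp add: v_def powr_diff powr_minus field_simps)
    also have "\<dots> = - ((p - 1) * \<Lambda> * (v s - b))"
      using \<open>\<Lambda> > 0\<close> by (simp add: b_def field_simps)
    finally show "(1 - p) * F s powr (- p) * F' s \<le> (p - 1) * \<Lambda> * (v s - b)"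
      by (simp add: algebra_simps)
  qed (use v_cont \<open>0 \<le> t\<close> in \<open>auto intro: continuous_intros\<close>)
  moreover have "v t > 0"
    using pos [of t] \<open>0 \<le> t\<close> by (simp add: v_def)
  ultimately have "(b - v 0) * exp ((p - 1) * \<Lambda> * t) < b"
    by (simp add: algebra_simps)
  then have "exp ((p - 1) * \<Lambda> * t) < b / (b - v 0)"
    using v_less by (simp add: pos_less_divide_eq mult.commute)
  also have "b / (b - v 0) = 1 / (1 - v 0 / b)"
    using \<open>b > 0\<close> by (simp add: field_simps)
  finally have "ln (exp ((p - 1) * \<Lambda> * t)) < ln (1 / (1 - v 0 / b))"
    using v_less \<open>b > 0\<close> by (subst ln_less_cancel_iff) auto
  then have "(p - 1) * \<Lambda> * t < ln (1 / (1 - v 0 / b))"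
    by simp
  moreover have "v 0 / b = \<Lambda> / k * F 0 powr (1 - p)"
    by (simp add: v_def b_def)
  ultimately show ?thesis
    using \<open>p > 1\<close> \<open>\<Lambda> > 0\<close> by (simp add: pos_less_divide_eq mult.commute)
qed

text \<open>The square removes the kink of the negative part at \<open>0\<close>.\<close>
lemma DERIV_negative_part_square:
  "((\<lambda>z. (min z 0)\<^sup>2) has_real_derivative 2 * min z 0) (at (z :: real))"
proof -
  consider "z < 0" | "z > 0" | "z = 0" by linarith
  then show ?thesis
  proof cases
    case 1
    have "((\<lambda>z. z\<^sup>2) has_real_derivative 2 * min z 0) (at z)"
      using 1 by (auto intro!: derivative_eq_intros)
    then show ?thesis
      by (rule has_field_derivative_transform_within_open [where S = "{..<0}"]) (use 1 in auto)
  next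
    case 2
    have "((\<lambda>z. 0) has_real_derivative 2 * min z 0) (at z)"
      using 2 by (auto intro!: derivative_eq_intros)
    then show ?thesis
      by (rule has_field_derivative_transform_within_open [where S = "{0<..}"]) (use 2 in auto)
  next
    case 3
    have "((\<lambda>h::real. min h 0) \<longlongrightarrow> 0) (at 0)"
      by (auto intro!: tendsto_eq_intros)
    then have "((\<lambda>h::real. (min h 0)\<^sup>2 / h) \<longlongrightarrow> 0) (at 0)"
      by (rule Lim_transform_eventually)
        (auto simp: eventually_at_filter min_def power2_eq_square)
    then show ?thesis
      using 3 by (simp add: DERIV_def)
  qed
qed

section \<open>Integration by parts on a weighted graph\<close>

context weighted_graph
begin

lemma verts_nonempty: "pverts G \<noteq> {}"
  using connected_graph
  by (auto simp: Digraph_Component.connected_def strongly_connected_def)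

lemma graph_integral_pos:
  assumes "\<And>x. x \<in> pverts G \<Longrightarrow> f x > 0"
  shows "graph_integral G \<mu> f > 0"
  unfolding graph_integral_def
  using assms verts_nonempty by (intro sum_pos mult_pos_pos measure_pos) auto

text \<open>
  Summing over arcs in both orientations and averaging symmetrises the integrand, because
  the weights are symmetric; the sum runs over ordered pairs, hence the factor \<open>1/2\<close>.
\<close>
lemma green_formula:
  "graph_integral G \<mu> (\<lambda>x. f x * laplacian G \<mu> \<omega> g x) =
    - (\<Sum>(x, y)\<in>parcs G. \<omega> x y * (f y - f x) * (g y - g x)) / 2"
proof -
  have nbhd: "{y. (x, y) \<in> parcs G} = parcs G `` {x}" for x
    by auto
  have fin: "finite (parcs G `` {x})" for x
    by (rule finite_Image [OF pair_finite_arcs])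
  have arcs: "(SIGMA x:pverts G. parcs G `` {x}) = parcs G"
    by (auto dest: in_arcsD1)
  let ?S = "\<Sum>(x, y)\<in>parcs G. \<omega> x y * f x * (g y - g x)"
  have "graph_integral G \<mu> (\<lambda>x. f x * laplacian G \<mu> \<omega> g x)
      = (\<Sum>x\<in>pverts G. \<Sum>y\<in>parcs G `` {x}. \<omega> x y * f x * (g y - g x))"
    unfolding graph_integral_def laplacian_def nbhd
    by (intro sum.cong refl)
      (auto simp: sum_distrib_left mult_ac dest: measure_pos)
  also have "\<dots> = ?S"
    by (subst sum.Sigma) (simp_all add: fin arcs)
  finally have S: "graph_integral G \<mu> (\<lambda>x. f x * laplacian G \<mu> \<omega> g x) = ?S" .
  have "?S = (\<Sum>(x, y)\<in>parcs G. \<omega> x y * f y * (g x - g y))"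
    by (rule sum.reindex_bij_witness [where i = prod.swap and j = prod.swap])
      (auto intro: arcs_symmetric, metis weight_sym)
  then have "2 * ?S = (\<Sum>(x, y)\<in>parcs G. \<omega> x y * f x * (g y - g x))
      + (\<Sum>(x, y)\<in>parcs G. \<omega> x y * f y * (g x - g y))"
    by simp
  also have "\<dots> = (\<Sum>(x, y)\<in>parcs G. - (\<omega> x y * (f y - f x) * (g y - g x)))"
    unfolding sum.distrib [symmetric]
    by (intro sum.cong refl) (auto simp: algebra_simps)
  also have "\<dots> = - (\<Sum>(x, y)\<in>parcs G. \<omega> x y * (f y - f x) * (g y - g x))"
    by (simp add: case_prod_beta sum_negf)
  finally show ?thesis
    using S by simp
qed

lemma laplacian_self_adjoint:
  "graph_integral G \<mu> (\<lambda>x. f x * laplacian G \<mu> \<omega> g x) =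
    graph_integral G \<mu> (\<lambda>x. g x * laplacian G \<mu> \<omega> f x)"
  by (simp add: green_formula mult_ac)

lemma laplacian_const: "laplacian G \<mu> \<omega> (\<lambda>x. c) x = 0"
  by (simp add: laplacian_def)

text \<open>
  Since \<open>z \<mapsto> min z 0\<close> is nondecreasing, the two differences in Green's formula never
  have opposite signs.
\<close>
lemma negative_part_laplacian_nonpos:
  "graph_integral G \<mu> (\<lambda>x. min (f x) 0 * laplacian G \<mu> \<omega> f x) \<le> 0"
proof -
  have "0 \<le> \<omega> x y * (min (f y) 0 - min (f x) 0) * (f y - f x)" if "(x, y) \<in> parcs G" for x y
  proof -
    have "0 \<le> (min (f y) 0 - min (f x) 0) * (f y - f x)"
      by (auto simp: min_def zero_le_mult_iff mult_nonneg_nonpos mult_nonpos_nonneg)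
    then show ?thesis
      using weight_pos [OF that] by (simp add: mult.assoc)
  qed
  then show ?thesis
    unfolding green_formula by (auto intro!: sum_nonneg)
qed

text \<open>
  The Laplacian integrates to zero, so \<open>l \<integral> \<phi> d\<mu> = \<integral> a \<phi> d\<mu>\<close>, and the right-hand side is
  positive because \<open>a \<ge> 0\<close> does not vanish identically.
\<close>
lemma positive_eigenvalue:
  assumes eig: "eigenfunction G \<mu> \<omega> a l \<phi>" and \<phi>: "\<And>x. x \<in> pverts G \<Longrightarrow> \<phi> x > 0"
    and a: "\<And>x. x \<in> pverts G \<Longrightarrow> a x \<ge> 0" and z: "z \<in> pverts G" "a z \<noteq> 0"
  shows "l > 0"
proof -
  have "l * graph_integral G \<mu> \<phi> = graph_integral G \<mu> (\<lambda>x. l * \<phi> x)"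
    by (simp add: graph_integral_def sum_distrib_left mult_ac)
  also have "\<dots> = graph_integral G \<mu> (\<lambda>x. a x * \<phi> x - laplacian G \<mu> \<omega> \<phi> x)"
    unfolding graph_integral_def
    using eig by (intro sum.cong refl) (auto simp: eigenfunction_def)
  also have "\<dots> = graph_integral G \<mu> (\<lambda>x. a x * \<phi> x) - graph_integral G \<mu> (laplacian G \<mu> \<omega> \<phi>)"
    by (simp add: graph_integral_def right_diff_distrib sum_subtractf)
  also have "graph_integral G \<mu> (laplacian G \<mu> \<omega> \<phi>) = 0"
    using laplacian_self_adjoint [of "\<lambda>x. 1" \<phi>]
    by (simp add: laplacian_const graph_integral_def)
  finally have "l * graph_integral G \<mu> \<phi> = graph_integral G \<mu> (\<lambda>x. a x * \<phi> x)"
    by simp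
  also have "\<dots> > 0"
    unfolding graph_integral_def
  proof (rule sum_pos2 [OF pair_finite_verts z(1)])
    show "0 < \<mu> z * (a z * \<phi> z)"
      using a [OF z(1)] z \<phi> measure_pos by (simp add: less_le)
    show "0 \<le> \<mu> x * (a x * \<phi> x)" if "x \<in> pverts G" for x
      using that a \<phi> measure_pos by (simp add: less_imp_le)
  qed
  finally show ?thesis
    using graph_integral_pos [of \<phi>] \<phi> by (simp add: zero_less_mult_iff)
qed

section \<open>Positivity and lifespan of solutions\<close>

lemma solution_regularity:
  assumes sol: "solution_on G \<mu> \<omega> a p u0 T u" and t: "t \<in> time_interval T"
    and x: "x \<in> pverts G"
  shows "continuous_on {0..t} (u x)"
    and "\<And>s. 0 < s \<Longrightarrow> s < t \<Longrightarrow> (u x has_real_derivative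
      laplacian G \<mu> \<omega> (\<lambda>y. u y s) x - a x * u x s + \<bar>u x s\<bar> powr (p - 1) * u x s) (at s)"
proof -
  obtain D where D: "\<And>s. s \<in> time_interval T \<Longrightarrow>
      (u x has_real_derivative D s) (at s within time_interval T)"
    and eq: "\<And>s. s \<in> time_interval T \<Longrightarrow> 0 < s \<Longrightarrow>
      D s = laplacian G \<mu> \<omega> (\<lambda>y. u y s) x - a x * u x s + \<bar>u x s\<bar> powr (p - 1) * u x s"
    using sol x unfolding solution_on_def by metis
  have sub: "{0..t} \<subseteq> time_interval T"
    using t le_less_trans [of _ "ereal t" T] by (auto simp: time_interval_def)
  have "continuous_on (time_interval T) (u x)"
    using D by (rule DERIV_continuous_on)
  then show "continuous_on {0..t} (u x)"
    using sub by (rule continuous_on_subset)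
  show "(u x has_real_derivative
      laplacian G \<mu> \<omega> (\<lambda>y. u y s) x - a x * u x s + \<bar>u x s\<bar> powr (p - 1) * u x s) (at s)"
    if s: "0 < s" "s < t" for s
  proof -
    have mem: "s \<in> time_interval T"
      using sub s by auto
    have "s \<in> interior (time_interval T)"
      using s interior_mono [OF sub] by auto
    then have "at s within time_interval T = at s"
      by (rule at_within_interior)
    with D [OF mem] have "(u x has_real_derivative D s) (at s)"
      by simp
    then show ?thesis
      unfolding eq [OF mem s(1)] .
  qed
qed

text \<open>
  The negative part has zero energy initially, and its energy \<open>E\<close> satisfies
  \<open>E' \<le> 2 M E\<close> on \<open>[0, t]\<close> when \<open>M\<close> bounds the reaction rate \<open>\<bar>u\<bar>\<^sup>p\<^sup>-\<^sup>1\<close> there, so Gronwall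
  keeps it zero. Such an \<open>M\<close> exists because \<open>u\<close> is continuous on the compact interval
  \<open>[0, t]\<close>.
\<close>
lemma solution_nonneg:
  assumes sol: "solution_on G \<mu> \<omega> a p u0 T u" and t: "t \<in> time_interval T"
    and "p > 1" and a: "\<And>x. x \<in> pverts G \<Longrightarrow> a x \<ge> 0"
    and u0: "\<And>x. x \<in> pverts G \<Longrightarrow> u0 x \<ge> 0" and x: "x \<in> pverts G"
  shows "u x t \<ge> 0"
proof -
  note cont = solution_regularity(1) [OF sol t] and deriv = solution_regularity(2) [OF sol t]
  have "0 \<le> t"
    using t by (simp add: time_interval_def)
  have "continuous_on {0..t} (\<lambda>s. \<Sum>x\<in>pverts G. \<bar>u x s\<bar>)"
    by (intro continuous_intros cont)
  then obtain r where "\<forall>s\<in>{0..t}. (\<Sum>x\<in>pverts G. \<bar>u x s\<bar>) \<le> (\<Sum>x\<in>pverts G. \<bar>u x r\<bar>)"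
    using \<open>0 \<le> t\<close> continuous_attains_sup [of "{0..t}" "\<lambda>s. \<Sum>x\<in>pverts G. \<bar>u x s\<bar>"]
    by (metis atLeastatMost_empty_iff2 compact_Icc not_less)
  moreover have "\<bar>u y s\<bar> \<le> (\<Sum>x\<in>pverts G. \<bar>u x s\<bar>)" if "y \<in> pverts G" for y s
    using that by (intro member_le_sum) auto
  ultimately obtain B where B: "\<And>y s. y \<in> pverts G \<Longrightarrow> s \<in> {0..t} \<Longrightarrow> \<bar>u y s\<bar> \<le> B"
    by (meson order_trans)
  define M where "M = B powr (p - 1)"
  have M: "\<bar>u y s\<bar> powr (p - 1) \<le> M" if "y \<in> pverts G" "s \<in> {0..t}" for y s
    unfolding M_def using B [OF that] \<open>p > 1\<close> by (intro powr_mono2) auto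
  define E where "E = (\<lambda>s. \<Sum>y\<in>pverts G. \<mu> y * (min (u y s) 0)\<^sup>2)"
  define R where "R = (\<lambda>s y. laplacian G \<mu> \<omega> (\<lambda>y. u y s) y - a y * u y s
      + \<bar>u y s\<bar> powr (p - 1) * u y s)"
  define E' where "E' = (\<lambda>s. \<Sum>y\<in>pverts G. \<mu> y * (2 * min (u y s) 0 * R s y))"
  have "E t \<le> E 0 * exp (2 * M * t)"
  proof (rule gronwall_exp [where f = E and f' = E', OF \<open>0 \<le> t\<close>])
    show "continuous_on {0..t} E"
      unfolding E_def by (intro continuous_intros cont)
    fix s assume s: "0 < s" "s < t"
    show "(E has_real_derivative E' s) (at s)"
      unfolding E_def E'_def
      by (intro DERIV_sum DERIV_cmult DERIV_chain2 [OF DERIV_negative_part_square])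
        (use deriv s in \<open>auto simp: R_def\<close>)
    have "E' s = 2 * graph_integral G \<mu> (\<lambda>y. min (u y s) 0 * laplacian G \<mu> \<omega> (\<lambda>y. u y s) y)
        + (\<Sum>y\<in>pverts G. \<mu> y * (2 * (\<bar>u y s\<bar> powr (p - 1) - a y) * (min (u y s) 0 * u y s)))"
      unfolding E'_def R_def graph_integral_def sum_distrib_left sum.distrib [symmetric]
      by (intro sum.cong refl) (simp add: algebra_simps)
    also have "\<dots> \<le> (\<Sum>y\<in>pverts G. \<mu> y * (2 * M * (min (u y s) 0)\<^sup>2))"
    proof -
      have "(\<Sum>y\<in>pverts G. \<mu> y * (2 * (\<bar>u y s\<bar> powr (p - 1) - a y) * (min (u y s) 0 * u y s)))
          \<le> (\<Sum>y\<in>pverts G. \<mu> y * (2 * M * (min (u y s) 0)\<^sup>2))"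
      proof (intro sum_mono mult_left_mono)
        fix y assume y: "y \<in> pverts G"
        have sq: "min (u y s) 0 * u y s = (min (u y s) 0)\<^sup>2"
          by (auto simp: min_def power2_eq_square)
        have "\<bar>u y s\<bar> powr (p - 1) - a y \<le> M"
          using M [OF y, of s] a [OF y] s by auto
        then show "2 * (\<bar>u y s\<bar> powr (p - 1) - a y) * (min (u y s) 0 * u y s)
            \<le> 2 * M * (min (u y s) 0)\<^sup>2"
          unfolding sq by (intro mult_right_mono) auto
        show "0 \<le> \<mu> y"
          using measure_pos [OF y] by simp
      qed
      then show ?thesis
        using negative_part_laplacian_nonpos [of "\<lambda>y. u y s"] by linarith
    qed
    also have "\<dots> = 2 * M * E s"
      by (simp add: E_def sum_distrib_left mult_ac)
    finally show "E' s \<le> 2 * M * E s" .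
  qed
  moreover have "E 0 = 0"
    using sol u0 by (simp add: E_def solution_on_def min_absorb2)
  moreover have nonneg: "\<And>y. y \<in> pverts G \<Longrightarrow> 0 \<le> \<mu> y * (min (u y t) 0)\<^sup>2"
    by (auto dest: measure_pos)
  then have "E t \<ge> 0"
    unfolding E_def by (intro sum_nonneg)
  ultimately have "E t = 0"
    by simp
  then have "\<mu> x * (min (u x t) 0)\<^sup>2 = 0"
    using nonneg x by (simp add: E_def sum_nonneg_eq_0_iff)
  then show ?thesis
    using measure_pos [OF x] by (simp add: min_def split: if_splits)
qed

text \<open>
  The weight \<open>\<psi>\<close> only has to satisfy the eigenvalue equation as an inequality, because it is
  integrated against \<open>u \<ge> 0\<close>. This lets one argument serve constant weights as well as
  eigenfunctions.
\<close>
lemma existence_time_bound: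
  fixes \<psi> :: "'v \<Rightarrow> real"
  assumes sol: "solution_on G \<mu> \<omega> a p u0 T u" and "p > 1"
    and a: "\<And>x. x \<in> pverts G \<Longrightarrow> a x \<ge> 0"
    and u0: "\<And>x. x \<in> pverts G \<Longrightarrow> u0 x \<ge> 0"
    and \<psi>: "\<And>x. x \<in> pverts G \<Longrightarrow> \<psi> x > 0"
    and super: "\<And>x. x \<in> pverts G \<Longrightarrow> - laplacian G \<mu> \<omega> \<psi> x + a x * \<psi> x \<le> \<Lambda> * \<psi> x"
    and "\<Lambda> > 0"
    and large: "graph_integral G \<mu> (\<lambda>x. \<psi> x * u0 x) >
      \<Lambda> powr (1 / (p - 1)) * graph_integral G \<mu> \<psi>"
  shows "T \<le> ereal (1 / ((p - 1) * \<Lambda>) *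
    ln (1 / (1 - \<Lambda> * graph_integral G \<mu> \<psi> powr (p - 1) *
      graph_integral G \<mu> (\<lambda>x. \<psi> x * u0 x) powr (1 - p))))"
    (is "T \<le> ereal ?bound")
proof -
  define K where "K = graph_integral G \<mu> \<psi>"
  define F where "F = (\<lambda>s. graph_integral G \<mu> (\<lambda>x. \<psi> x * u x s))"
  have "K > 0"
    unfolding K_def using \<psi> by (rule graph_integral_pos)
  have F0: "F 0 = graph_integral G \<mu> (\<lambda>x. \<psi> x * u0 x)"
    using sol by (simp add: F_def graph_integral_def solution_on_def)
  have F0_large: "\<Lambda> powr (1 / (p - 1)) * K < F 0"
    using large by (simp add: F0 K_def)
  have F0_pos: "F 0 > 0"
    by (rule le_less_trans [OF _ F0_large]) (use \<open>K > 0\<close> in simp)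
  have "\<Lambda> * K powr (p - 1) = (\<Lambda> powr (1 / (p - 1)) * K) powr (p - 1)"
    using \<open>\<Lambda> > 0\<close> \<open>K > 0\<close> \<open>p > 1\<close> by (simp add: powr_mult powr_powr)
  also have "\<dots> < F 0 powr (p - 1)"
    using F0_large \<open>K > 0\<close> \<open>p > 1\<close> by (intro powr_less_mono2) auto
  finally have "K powr (1 - p) * (\<Lambda> * K powr (p - 1)) < K powr (1 - p) * F 0 powr (p - 1)"
    using \<open>K > 0\<close> by (intro mult_strict_left_mono) auto
  then have large': "\<Lambda> < K powr (1 - p) * F 0 powr (p - 1)"
    using \<open>K > 0\<close> by (simp add: mult.left_commute flip: powr_add)
  have before: "t < ?bound" if t: "t \<in> time_interval T" for t
  proof -
    note cont = solution_regularity(1) [OF sol t] and deriv = solution_regularity(2) [OF sol t]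
    have "0 \<le> t"
      using t by (simp add: time_interval_def)
    define F' where "F' = (\<lambda>s. graph_integral G \<mu> (\<lambda>x. \<psi> x *
      (laplacian G \<mu> \<omega> (\<lambda>y. u y s) x - a x * u x s + \<bar>u x s\<bar> powr (p - 1) * u x s)))"
    have "t < 1 / ((p - 1) * \<Lambda>) * ln (1 / (1 - \<Lambda> / K powr (1 - p) * F 0 powr (1 - p)))"
    proof (rule bernoulli_blow_up_time [where F = F and F' = F'])
      show "continuous_on {0..t} F"
        unfolding F_def graph_integral_def by (intro continuous_intros cont)
      fix s assume s: "0 < s" "s < t"
      show "(F has_real_derivative F' s) (at s)"
        unfolding F_def F'_def graph_integral_def
        by (intro DERIV_sum DERIV_cmult deriv s)
      have u: "u x s \<ge> 0" if "x \<in> pverts G" for x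
      proof (rule solution_nonneg [OF sol _ \<open>p > 1\<close> a u0 that])
        show "s \<in> time_interval T"
          using t s less_trans [of "ereal s" "ereal t" T] by (simp add: time_interval_def)
      qed
      have reaction: "\<bar>u x s\<bar> powr (p - 1) * u x s = u x s powr p" if "x \<in> pverts G" for x
        using u [OF that] by (cases "u x s = 0") (auto simp: powr_diff)
      have split: "F' s = graph_integral G \<mu> (\<lambda>x. \<psi> x * laplacian G \<mu> \<omega> (\<lambda>y. u y s) x)
          + (\<Sum>x\<in>pverts G. \<mu> x * (- (a x * \<psi> x) * u x s) + \<mu> x * \<psi> x * u x s powr p)"
        unfolding F'_def graph_integral_def sum.distrib [symmetric]
        by (intro sum.cong refl) (simp only: reaction, simp add: algebra_simps)
      have "F' s = (\<Sum>x\<in>pverts G. \<mu> x * ((laplacian G \<mu> \<omega> \<psi> x - a x * \<psi> x) * u x s))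
          + (\<Sum>x\<in>pverts G. \<mu> x * \<psi> x * u x s powr p)"
        unfolding split laplacian_self_adjoint [of \<psi> "\<lambda>y. u y s"]
        unfolding graph_integral_def sum.distrib [symmetric]
        by (intro sum.cong refl) (simp add: algebra_simps)
      moreover have "- \<Lambda> * F s
          \<le> (\<Sum>x\<in>pverts G. \<mu> x * ((laplacian G \<mu> \<omega> \<psi> x - a x * \<psi> x) * u x s))"
      proof -
        have "- \<Lambda> * F s = (\<Sum>x\<in>pverts G. \<mu> x * ((- \<Lambda> * \<psi> x) * u x s))"
          by (simp add: F_def graph_integral_def sum_distrib_left mult_ac sum_negf)
        also have "\<dots> \<le> (\<Sum>x\<in>pverts G. \<mu> x * ((laplacian G \<mu> \<omega> \<psi> x - a x * \<psi> x) * u x s))"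
        proof (intro sum_mono mult_left_mono mult_right_mono u)
          fix x assume x: "x \<in> pverts G"
          show "- \<Lambda> * \<psi> x \<le> laplacian G \<mu> \<omega> \<psi> x - a x * \<psi> x"
            using super [OF x] by simp
          show "0 \<le> \<mu> x"
            using measure_pos [OF x] by simp
        qed
        finally show ?thesis .
      qed
      moreover have "K powr (1 - p) * F s powr p \<le> (\<Sum>x\<in>pverts G. \<mu> x * \<psi> x * u x s powr p)"
        using jensen_powr [where S = "pverts G" and c = "\<lambda>x. \<mu> x * \<psi> x" and z = "\<lambda>x. u x s"]
          \<open>p > 1\<close> u \<psi> \<open>K > 0\<close>
        by (simp add: K_def F_def graph_integral_def mult.assoc less_imp_le measure_pos)
      ultimately show "- \<Lambda> * F s + K powr (1 - p) * F s powr p \<le> F' s"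
        by linarith
    qed (use \<open>p > 1\<close> \<open>\<Lambda> > 0\<close> \<open>K > 0\<close> \<open>0 \<le> t\<close> F0_pos large' in auto)
    also have "\<Lambda> / K powr (1 - p) = \<Lambda> * K powr (p - 1)"
      using \<open>K > 0\<close> by (simp add: powr_diff)
    finally show ?thesis
      by (simp add: K_def F0)
  qed
  show ?thesis
  proof (rule ccontr)
    \<comment> \<open>Otherwise \<open>?bound\<close> itself would be a time of existence, contradicting strictness.\<close>
    assume "\<not> T \<le> ereal ?bound"
    then have less: "ereal ?bound < T"
      by (simp only: not_le)
    have "0 \<in> time_interval T"
      using sol by (simp add: solution_on_def time_interval_def zero_ereal_def)
    then have "0 < ?bound"
      by (rule before)
    then have "?bound \<in> time_interval T"
      unfolding time_interval_def using less by (intro CollectI conjI less_imp_le)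
    then have "?bound < ?bound"
      by (rule before)
    then show False
      by (rule less_irrefl [THEN notE])
  qed
qed

end

theorem theorem2p4:
  fixes G :: "'v pair_pre_digraph"
    and \<mu> :: "'v \<Rightarrow> real" and \<omega> :: "'v \<Rightarrow> 'v \<Rightarrow> real"
    and a :: "'v \<Rightarrow> real" and p :: real
    and u0 :: "'v \<Rightarrow> real" and u :: "'v \<Rightarrow> real \<Rightarrow> real"
  assumes "weighted_graph G \<mu> \<omega>"
    and "p > 1"
    and "\<forall>x\<in>pverts G. a x \<ge> 0" and "\<exists>x\<in>pverts G. a x \<noteq> 0"
    and "\<forall>x\<in>pverts G. u0 x \<ge> 0"
    and "solution_on G \<mu> \<omega> a p u0 (T_max G \<mu> \<omega> a p u0) u"
  shows
    "(graph_integral G \<mu> u0 > (MAX x\<in>pverts G. a x) powr (1 / (p - 1)) * graph_volume G \<mu> \<longrightarrow>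
       T_max G \<mu> \<omega> a p u0 \<le>
         ereal (1 / ((p - 1) * (MAX x\<in>pverts G. a x)) *
           ln (1 / (1 - graph_volume G \<mu> powr (p - 1) * (MAX x\<in>pverts G. a x) *
                          graph_integral G \<mu> u0 powr (1 - p)))))
     \<and>
     (\<forall>\<phi>. eigenfunction G \<mu> \<omega> a (first_eigenvalue G \<mu> \<omega> a) \<phi> \<longrightarrow>
       (\<forall>x\<in>pverts G. \<phi> x > 0) \<longrightarrow>
       graph_integral G \<mu> (\<lambda>x. \<phi> x * u0 x) >
         first_eigenvalue G \<mu> \<omega> a powr (1 / (p - 1)) * graph_integral G \<mu> \<phi> \<longrightarrow>
       T_max G \<mu> \<omega> a p u0 \<le>
         ereal (1 / ((p - 1) * first_eigenvalue G \<mu> \<omega> a) *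
           ln (1 / (1 - first_eigenvalue G \<mu> \<omega> a * graph_integral G \<mu> \<phi> powr (p - 1) *
                          graph_integral G \<mu> (\<lambda>x. \<phi> x * u0 x) powr (1 - p)))))"
proof (intro conjI impI allI)
  interpret weighted_graph G \<mu> \<omega>
    by fact
  obtain z where z: "z \<in> pverts G" "a z \<noteq> 0"
    using assms by blast
  have a: "\<And>x. x \<in> pverts G \<Longrightarrow> a x \<ge> 0" and u0: "\<And>x. x \<in> pverts G \<Longrightarrow> u0 x \<ge> 0"
    using assms by auto
  note bound = existence_time_bound [OF \<open>solution_on G \<mu> \<omega> a p u0 _ u\<close> \<open>p > 1\<close> a u0]
  {
    let ?A = "MAX x\<in>pverts G. a x"
    assume large: "graph_integral G \<mu> u0 > ?A powr (1 / (p - 1)) * graph_volume G \<mu>"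
    have le: "a x \<le> ?A" if "x \<in> pverts G" for x
      using that by simp
    have "?A > 0"
      using le [OF z(1)] a [OF z(1)] z(2) by linarith
    then show "T_max G \<mu> \<omega> a p u0 \<le>
         ereal (1 / ((p - 1) * ?A) *
           ln (1 / (1 - graph_volume G \<mu> powr (p - 1) * ?A *
                          graph_integral G \<mu> u0 powr (1 - p))))"
      using bound [of "\<lambda>x. 1" ?A] large le
      by (simp add: laplacian_const graph_volume_def mult_ac)
  next
    fix \<phi>
    assume eig: "eigenfunction G \<mu> \<omega> a (first_eigenvalue G \<mu> \<omega> a) \<phi>"
      and \<phi>: "\<forall>x\<in>pverts G. \<phi> x > 0"
      and large: "graph_integral G \<mu> (\<lambda>x. \<phi> x * u0 x) >
         first_eigenvalue G \<mu> \<omega> a powr (1 / (p - 1)) * graph_integral G \<mu> \<phi>"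
    show "T_max G \<mu> \<omega> a p u0 \<le>
         ereal (1 / ((p - 1) * first_eigenvalue G \<mu> \<omega> a) *
           ln (1 / (1 - first_eigenvalue G \<mu> \<omega> a * graph_integral G \<mu> \<phi> powr (p - 1) *
                          graph_integral G \<mu> (\<lambda>x. \<phi> x * u0 x) powr (1 - p))))"
    proof (rule bound)
      show "first_eigenvalue G \<mu> \<omega> a > 0"
        using positive_eigenvalue [OF eig _ a z] \<phi> by blast
    qed (use \<phi> eig large in \<open>auto simp: eigenfunction_def\<close>)
  }
qed

end
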